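(* Let $N\ge1$. For all positive integers $\alpha,\beta$ with $\alpha+\beta\le N+1$, all $m\ge1$ and all $\gamma_1,\dots,\gamma_m\in\{1,\dots,N\}$, $$\left.\frac{\partial^{m+2}F_{A_N}}{\partial t_\alpha\,\partial t_\beta\,\partial t_{N+1-\gamma_1}\cdots\partial t_{N+1-\gamma_m}}\right|_{t=0}=(-1)^{m-1}(m-1)!\cdot\widehat P_{\alpha\beta}(\gamma_1,\dots,\gamma_m).$$
   Context: The $A_N$ Frobenius potential $F_{A_N}$ ($N\ge1$). Let $\Lambda=\frac{x^{N+1}}{N+1}+y^2+\sum_{k=1}^Nv_kx^{k-1}$ with parameters $v=(v_1,\dots,v_N)\in\mathbb{C}^N$, and let $c_{ab}^k(v)$ be the structure constants of the ring $\mathbb{C}[x,y]/(\partial\Lambda/\partial x,\partial\Lambda/\partial y)$ in the basis of classes of $x^{k-1}$, $1\le k\le N$. Define the product $\frac{\partial}{\partial v_a}\circ\frac{\partial}{\partial v_b}=\sum_kc_{ab}^k(v)\frac{\partial}{\partial v_k}$ on vector fields and the pairing $\eta(\frac{\partial}{\partial v_a},\frac{\partial}{\partial v_b})=c_{ab}^N(v)$. The flat coordinates $t_1,\dots,t_N$ are related to $v$ by the invertible polynomial change $$v_\gamma=\sum_{\substack{a_1,\dots,a_N\ge0\\ \sum_k(N+2-k)a_k=N+2-\gamma}}\frac{(|a|+\gamma-2)!}{(\gamma-1)!}\prod_{k=1}^N\frac{t_k^{a_k}}{a_k!},\qquad|a|=\sum_ka_k,$$ and in them $\eta(\frac{\partial}{\partial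 t_\alpha},\frac{\partial}{\partial t_\beta})=\delta_{\alpha+\beta,N+1}$. $F_{A_N}\in\mathbb{Q}[t_1,\dots,t_N]$ is the unique polynomial without terms of degree $\le2$ such that $\frac{\partial^3F_{A_N}}{\partial t_\alpha\partial t_\beta\partial t_\gamma}=\eta(\frac{\partial}{\partial t_\alpha}\circ\frac{\partial}{\partial t_\beta},\frac{\partial}{\partial t_\gamma})$. For positive integers $i,j,m,\gamma_1,\dots,\gamma_m$, $\widehat P_{ij}(\gamma_1,\dots,\gamma_m)$ is the number of pairs of ordered $m$-tuples of positive integers $(i_1,\dots,i_m)$, $(j_1,\dots,j_m)$ with $\sum_ki_k=i$, $\sum_kj_k=j$ and $i_k+j_k=\gamma_k+1$ for all $k$. *)

theory Defs
  imports Complex_Main "HOL-Library.Poly_Mapping" "HOL-Computational_Algebra.Polynomial"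
begin

section \<open>Multivariate polynomials over the rationals\<close>

text \<open>
  A monomial is a finitely supported exponent function; a polynomial is a finitely supported
  coefficient function on monomials, with the convolution product of
  \<^theory>\<open>HOL-Library.Poly_Mapping\<close>. The variables are indexed by all natural numbers; the
  variables \<open>t\<^sub>1, \<dots>, t\<^sub>N\<close> are those with index in \<open>{1..N}\<close>.
\<close>

type_synonym monomial = "nat \<Rightarrow>\<^sub>0 nat"
type_synonym rat_mpoly = "monomial \<Rightarrow>\<^sub>0 rat"

definition mono_degree :: "monomial \<Rightarrow> nat" where
  "mono_degree a = (\<Sum>k\<in>Poly_Mapping.keys a. Poly_Mapping.lookup a k)"

definition mpoly_eval :: "rat_mpoly \<Rightarrow> (nat \<Rightarrow> complex) \<Rightarrow> complex" where
  "mpoly_eval p t =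
     (\<Sum>a\<in>Poly_Mapping.keys p. of_rat (Poly_Mapping.lookup p a) *
        (\<Prod>k\<in>Poly_Mapping.keys a. t k ^ Poly_Mapping.lookup a k))"

text \<open>
  The truncated subtraction of exponents is harmless: where it truncates, the coefficient is \<open>0\<close>.
\<close>

definition pd :: "nat \<Rightarrow> rat_mpoly \<Rightarrow> rat_mpoly" where
  "pd i p =
     (\<Sum>a\<in>Poly_Mapping.keys p.
        Poly_Mapping.single (a - Poly_Mapping.single i 1)
          (of_nat (Poly_Mapping.lookup a i) * Poly_Mapping.lookup p a))"


section \<open>The Jacobian ring of the versal unfolding of the singularity of type A\<close>

text \<open>
  Elements of \<open>\<complex>[x,y]\<close> are polynomials in \<open>y\<close> (outer variable) whose coefficients are polynomials
  in \<open>x\<close> (inner variable). Thus \<open>[:p:]\<close> embeds \<open>p \<in> \<complex>[x]\<close>, the partial derivative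
  in \<open>y\<close> is \<^const>\<open>pderiv\<close>, and the one in \<open>x\<close> acts on the coefficients.
\<close>

type_synonym bipoly = "complex poly poly"

definition x_pow :: "nat \<Rightarrow> bipoly" where
  "x_pow n = [:monom 1 n:]"

definition scalar :: "complex \<Rightarrow> bipoly" where
  "scalar c = [:[:c:]:]"

definition unfolding_A :: "nat \<Rightarrow> (nat \<Rightarrow> complex) \<Rightarrow> bipoly" where
  "unfolding_A N v =
     scalar (1 / of_nat (N + 1)) * x_pow (N + 1) + monom 1 2
       + (\<Sum>k = 1..N. scalar (v k) * x_pow (k - 1))"

definition diff_x :: "bipoly \<Rightarrow> bipoly" where
  "diff_x p = map_poly pderiv p"

definition diff_y :: "bipoly \<Rightarrow> bipoly" where
  "diff_y p = pderiv p"

definition jacobian_ideal :: "nat \<Rightarrow> (nat \<Rightarrow> complex) \<Rightarrow> bipoly set" where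
  "jacobian_ideal N v =
     {p * diff_x (unfolding_A N v) + q * diff_y (unfolding_A N v) | p q. True}"

text \<open>
  \<open>struct_const N v a b k\<close> is the coefficient \<open>c\<^sub>a\<^sub>b\<^sup>k(v)\<close>: the classes of \<open>x\<^sup>k\<^sup>-\<^sup>1\<close>, \<open>1 \<le> k \<le> N\<close>, form
  a basis of the Jacobian ring, and the product of the classes of \<open>x\<^sup>a\<^sup>-\<^sup>1\<close> and \<open>x\<^sup>b\<^sup>-\<^sup>1\<close> is expanded
  in it. Coefficients outside \<open>{1..N}\<close> are set to \<open>0\<close> to make the description definite.
\<close>

definition struct_const ::
  "nat \<Rightarrow> (nat \<Rightarrow> complex) \<Rightarrow> nat \<Rightarrow> nat \<Rightarrow> nat \<Rightarrow> complex" where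
  "struct_const N v a b =
     (THE c. (\<forall>k. k \<notin> {1..N} \<longrightarrow> c k = 0) \<and>
        x_pow (a - 1) * x_pow (b - 1) - (\<Sum>k = 1..N. scalar (c k) * x_pow (k - 1))
          \<in> jacobian_ideal N v)"


section \<open>Product and pairing on tangent vectors\<close>

text \<open>
  A tangent vector at the point \<open>v\<close> is given by its components with respect to
  \<open>\<partial>/\<partial>v\<^sub>1, \<dots>, \<partial>/\<partial>v\<^sub>N\<close>.
\<close>

definition tangent_prod ::
  "nat \<Rightarrow> (nat \<Rightarrow> complex) \<Rightarrow> (nat \<Rightarrow> complex) \<Rightarrow> (nat \<Rightarrow> complex) \<Rightarrow> nat \<Rightarrow> complex" where
  "tangent_prod N v X Y k =
     (\<Sum>a = 1..N. \<Sum>b = 1..N. X a * Y b * struct_const N v a b k)"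

definition eta ::
  "nat \<Rightarrow> (nat \<Rightarrow> complex) \<Rightarrow> (nat \<Rightarrow> complex) \<Rightarrow> (nat \<Rightarrow> complex) \<Rightarrow> complex" where
  "eta N v X Y = (\<Sum>a = 1..N. \<Sum>b = 1..N. X a * Y b * struct_const N v a b N)"


section \<open>Flat coordinates\<close>

definition flat_exponents :: "nat \<Rightarrow> nat \<Rightarrow> monomial set" where
  "flat_exponents N g =
     {a. Poly_Mapping.keys a \<subseteq> {1..N} \<and>
         (\<Sum>k = 1..N. (N + 2 - k) * Poly_Mapping.lookup a k) = N + 2 - g}"

lemma finite_flat_exponents: "finite (flat_exponents N g)"
proof -
  let ?F = "{f :: nat \<Rightarrow> nat. \<forall>k. (k \<in> {1..N} \<longrightarrow> f k \<in> {..N + 2 - g}) \<and> (k \<notin> {1..N} \<longrightarrow> f k = 0)}"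
  have "Poly_Mapping.lookup a \<in> ?F" if a: "a \<in> flat_exponents N g" for a
  proof -
    have "Poly_Mapping.lookup a k \<le> N + 2 - g" if k: "k \<in> {1..N}" for k
    proof -
      have "Poly_Mapping.lookup a k \<le> (N + 2 - k) * Poly_Mapping.lookup a k"
        using k by auto
      also have "\<dots> \<le> (\<Sum>k = 1..N. (N + 2 - k) * Poly_Mapping.lookup a k)"
        using k by (intro member_le_sum) auto
      finally show ?thesis
        using a by (simp add: flat_exponents_def)
    qed
    moreover have "Poly_Mapping.lookup a k = 0" if "k \<notin> {1..N}" for k
      using a that by (auto simp: flat_exponents_def in_keys_iff)
    ultimately show ?thesis by auto
  qed
  then have "Poly_Mapping.lookup ` flat_exponents N g \<subseteq> ?F"
    by (rule image_subsetI)
  moreover have "finite ?F"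
    by (rule finite_set_of_finite_funs) auto
  ultimately have "finite (Poly_Mapping.lookup ` flat_exponents N g)"
    by (rule finite_subset)
  moreover have "inj_on Poly_Mapping.lookup (flat_exponents N g)"
    by (auto simp: inj_on_def intro: poly_mapping_eqI)
  ultimately show ?thesis
    by (rule finite_imageD)
qed

text \<open>
  The polynomial \<open>v\<^sub>g\<close> in \<open>t\<^sub>1, \<dots>, t\<^sub>N\<close>. For \<open>1 \<le> g \<le> N\<close> every exponent in the range of summation
  has degree at least \<open>1\<close>, so the argument of the factorial is not truncated.
\<close>

definition v_poly :: "nat \<Rightarrow> nat \<Rightarrow> rat_mpoly" where
  "v_poly N g =
     (\<Sum>a\<in>flat_exponents N g.
        Poly_Mapping.single a
          (fact (mono_degree a + g - 2) / fact (g - 1)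
             * (\<Prod>k = 1..N. 1 / fact (Poly_Mapping.lookup a k))))"

definition v_of :: "nat \<Rightarrow> (nat \<Rightarrow> complex) \<Rightarrow> nat \<Rightarrow> complex" where
  "v_of N t g = mpoly_eval (v_poly N g) t"

text \<open>The \<open>v\<close>-components of the coordinate vector field \<open>\<partial>/\<partial>t\<^sub>\<alpha>\<close> at the point with flat coordinates \<open>t\<close>.\<close>

definition flat_field :: "nat \<Rightarrow> (nat \<Rightarrow> complex) \<Rightarrow> nat \<Rightarrow> nat \<Rightarrow> complex" where
  "flat_field N t \<alpha> g = mpoly_eval (pd \<alpha> (v_poly N g)) t"


section \<open>The Frobenius potential\<close>

text \<open>\<open>is_A_potential N F\<close> is the property that characterises \<open>F = F\<^bsub>A\<^sub>N\<^esub>\<close> uniquely.\<close>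

definition is_A_potential :: "nat \<Rightarrow> rat_mpoly \<Rightarrow> bool" where
  "is_A_potential N F \<longleftrightarrow>
     (\<forall>a\<in>Poly_Mapping.keys F. Poly_Mapping.keys a \<subseteq> {1..N} \<and> mono_degree a > 2) \<and>
     (\<forall>\<alpha>\<in>{1..N}. \<forall>\<beta>\<in>{1..N}. \<forall>\<gamma>\<in>{1..N}. \<forall>t.
        mpoly_eval (pd \<alpha> (pd \<beta> (pd \<gamma> F))) t =
          eta N (v_of N t)
            (tangent_prod N (v_of N t) (flat_field N t \<alpha>) (flat_field N t \<beta>))
            (flat_field N t \<gamma>))"


section \<open>Counting pairs of tuples\<close>

text \<open>\<open>P_hat i j [\<gamma>\<^sub>1, \<dots>, \<gamma>\<^sub>m]\<close>; the tuples are lists, so their indices start at \<open>0\<close>.\<close>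

definition P_hat :: "nat \<Rightarrow> nat \<Rightarrow> nat list \<Rightarrow> nat" where
  "P_hat i j \<gamma>s =
     card {(is, js). length is = length \<gamma>s \<and> length js = length \<gamma>s \<and>
        (\<forall>k < length \<gamma>s. is ! k > 0 \<and> js ! k > 0 \<and> is ! k + js ! k = \<gamma>s ! k + 1) \<and>
        sum_list is = i \<and> sum_list js = j}"

end

theory Submission
  imports Defs
begin

text \<open>
  Put \<open>s\<^sub>\<gamma> = t\<^bsub>N+1-\<gamma>\<^esub>\<close> and \<open>X(k) = k - \<Sum>\<^sub>\<gamma> s\<^sub>\<gamma> k\<^bsup>-\<gamma>\<^esup>\<close>, and let \<open>\<phi>\<^sub>a(x)\<close> be the coefficient of \<open>k\<^bsup>-a\<^esup>\<close> in
  \<open>1/(X(k) - x)\<close>. The multinomial formula for \<open>v\<close> says that \<open>\<phi>\<^sub>1, \<dots>, \<phi>\<^sub>N\<close> represent the flat vector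
  fields in the Jacobian ring and that \<open>\<phi>\<^bsub>N+1\<^esub> = \<partial>\<Lambda>/\<partial>x\<close>. Multiplication by \<open>x\<close> has a Toeplitz matrix in
  the basis \<open>\<phi>\<^sub>a\<close>, which gives \<open>\<eta>(\<phi>\<^sub>a, \<phi>\<^sub>b) = \<delta>\<^bsub>a+b,N+1\<^esub>\<close>. The partial fraction identity
  \<open>1/((X(k) - x)(X(l) - x)) = (1/(X(k) - x) - 1/(X(l) - x)) / (X(l) - X(k))\<close> becomes
  \<open>\<phi>\<^sub>\<alpha> \<phi>\<^sub>\<beta> + \<Sum>\<^sub>\<delta> s\<^sub>\<delta> \<Sum>\<^bsub>i+j=\<delta>+1\<^esub> \<phi>\<^bsub>\<alpha>-i\<^esub> \<phi>\<^bsub>\<beta>-j\<^esub> = \<phi>\<^bsub>\<alpha>+\<beta>-1\<^esub>\<close>. Pairing it with another \<open>\<phi>\<close> yields a linear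
  recursion for the third derivatives of \<open>F\<close> when \<open>\<alpha> + \<beta> \<le> N + 1\<close>. Differentiated repeatedly and
  evaluated at \<open>t = 0\<close>, it is the recursion of the tuple counts obtained by splitting off one entry.
\<close>

section \<open>The generating polynomials\<close>

text \<open>
  The recursion is \<open>(X(k) - x) \<Sum>\<^sub>a \<phi>\<^sub>a(x) k\<^bsup>-a\<^esup> = 1\<close>. As \<open>flat_poly s 0 = 0\<close>, truncated subtraction in the
  index acts like \<open>\<phi>\<^sub>a = 0\<close> for \<open>a \<le> 0\<close>.
\<close>

fun flat_poly :: "(nat \<Rightarrow> 'a::comm_ring_1) \<Rightarrow> nat \<Rightarrow> 'a poly" where
  "flat_poly s 0 = 0"
| "flat_poly s (Suc n) =
     of_bool (n = 0) + pCons 0 (flat_poly s n) + (\<Sum>\<gamma> = 1..n. smult (s \<gamma>) (flat_poly s (n - \<gamma>)))"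

declare flat_poly.simps(2) [simp del]

lemma flat_poly_1 [simp]: "flat_poly s (Suc 0) = 1"
  by (simp add: flat_poly.simps(2))

text \<open>Terms with \<open>\<gamma> \<ge> n\<close> vanish because
  \<open>flat_poly s 0 = 0\<close>. The common bound \<open>M\<close> lets recursions at different
  indices be combined termwise.\<close>

lemma flat_poly_Suc:
  assumes "0 < n" "n \<le> M"
  shows "flat_poly s (Suc n) =
    pCons 0 (flat_poly s n) + (\<Sum>\<gamma> = 1..M. smult (s \<gamma>) (flat_poly s (n - \<gamma>)))"
proof -
  have "(\<Sum>\<gamma> = 1..n. smult (s \<gamma>) (flat_poly s (n - \<gamma>))) =
        (\<Sum>\<gamma> = 1..M. smult (s \<gamma>) (flat_poly s (n - \<gamma>)))"
    using assms by (intro sum.mono_neutral_left) auto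
  then show ?thesis
    using assms by (simp add: flat_poly.simps(2))
qed

text \<open>Only multiplication by \<open>x\<close> in the recursion reaches the top degree, so each
  polynomial is monic of degree one below its index.\<close>

lemma coeff_flat_poly_ge:
  "n \<le> c \<Longrightarrow> coeff (flat_poly s (Suc n)) c = of_bool (c = n)"
proof (induction n arbitrary: c rule: less_induct)
  case (less n)
  have low: "coeff (flat_poly s m) d = 0" if "m \<le> n" "m \<le> d" for m d
    using that less.IH[of "m - 1" d] by (cases m) auto
  show ?case
  proof (cases n)
    case 0
    then show ?thesis by (simp add: coeff_1)
  next
    case (Suc k)
    obtain e where e: "c = Suc e"
      using less.prems Suc by (cases c) auto
    have "coeff (flat_poly s (n - \<gamma>)) c = 0" for \<gamma>
      using less.prems by (intro low) auto
    then show ?thesis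
      using less.prems less.IH[of k e] Suc e
      by (simp add: flat_poly.simps(2)[of s "Suc k"] coeff_sum)
  qed
qed

lemma degree_flat_poly: "degree (flat_poly s (Suc n)) = n"
proof (rule antisym)
  show "degree (flat_poly s (Suc n)) \<le> n"
    by (intro degree_le) (simp add: coeff_flat_poly_ge)
  show "n \<le> degree (flat_poly s (Suc n))"
    by (intro le_degree) (simp add: coeff_flat_poly_ge)
qed

text \<open>The coefficient form of the partial fraction identity. Induction on
  \<open>\<beta>\<close> moves a factor \<open>x\<close> from the second polynomial to the first;
  boundary terms of the convolution absorb the corrections from the two recursions.\<close>

lemma flat_poly_mult:
  assumes "0 < \<alpha>" "0 < \<beta>" "\<alpha> + \<beta> \<le> Suc M"
  shows "flat_poly s \<alpha> * flat_poly s \<beta> +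
      (\<Sum>\<delta> = 1..M. smult (s \<delta>)
         (\<Sum>i = 1..\<delta>. flat_poly s (\<alpha> - i) * flat_poly s (\<beta> - (Suc \<delta> - i))))
    = flat_poly s (\<alpha> + \<beta> - 1)"
  using assms
proof (induction \<beta> arbitrary: \<alpha>)
  case 0
  then show ?case by simp
next
  case (Suc \<beta>)
  let ?p = "flat_poly s"
  show ?case
  proof (cases "\<beta> = 0")
    case True
    have "?p (\<alpha> - i) * ?p (1 - (Suc \<delta> - i)) = 0" if "i \<in> {1..\<delta>}" for i \<delta>
      using that by simp
    then show ?thesis using True by simp
  next
    case False
    \<comment> \<open>Both sides are the sum of \<open>?g i\<close> over
      \<open>0 \<le> i \<le> \<delta>\<close>; the left singles out \<open>i = 0\<close>, the right
      \<open>i = \<delta>\<close>.\<close>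
    have shift: "(\<Sum>i = 1..\<delta>. ?p (\<alpha> - i) * ?p (Suc \<beta> - (Suc \<delta> - i))) + ?p \<alpha> * ?p (\<beta> - \<delta>)
        = (\<Sum>i = 1..\<delta>. ?p (Suc \<alpha> - i) * ?p (\<beta> - (Suc \<delta> - i))) + ?p (\<alpha> - \<delta>) * ?p \<beta>"
      if "\<delta> \<in> {1..M}" for \<delta>
    proof -
      let ?g = "\<lambda>i. ?p (\<alpha> - i) * ?p (\<beta> - (\<delta> - i))"
      have "(\<Sum>i = 1..\<delta>. ?p (\<alpha> - i) * ?p (Suc \<beta> - (Suc \<delta> - i))) = (\<Sum>i = 1..\<delta>. ?g i)"
        by (intro sum.cong) (auto simp: Suc_diff_le)
      moreover have "(\<Sum>i = 1..\<delta>. ?p (Suc \<alpha> - i) * ?p (\<beta> - (Suc \<delta> - i))) = (\<Sum>i<\<delta>. ?g i)"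
        by (intro sum.reindex_bij_witness[of _ Suc "\<lambda>i. i - 1"]) auto
      moreover have "(\<Sum>i = 1..\<delta>. ?g i) + ?g 0 = (\<Sum>i<\<delta>. ?g i) + ?g \<delta>"
        using sum.atLeast_Suc_atMost[of 0 \<delta> ?g] sum.lessThan_Suc[of ?g \<delta>]
        by (simp add: lessThan_Suc_atMost atMost_atLeast0 add.commute)
      ultimately show ?thesis by simp
    qed
    have "?p \<alpha> * ?p (Suc \<beta>) + (\<Sum>\<delta> = 1..M. smult (s \<delta>)
         (\<Sum>i = 1..\<delta>. ?p (\<alpha> - i) * ?p (Suc \<beta> - (Suc \<delta> - i))))
       = pCons 0 (?p \<alpha> * ?p \<beta>) + (\<Sum>\<delta> = 1..M. smult (s \<delta>)
         ((\<Sum>i = 1..\<delta>. ?p (\<alpha> - i) * ?p (Suc \<beta> - (Suc \<delta> - i))) + ?p \<alpha> * ?p (\<beta> - \<delta>)))"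
      using Suc.prems False
      by (simp add: flat_poly_Suc[of \<beta> M] algebra_simps sum_distrib_left sum.distrib smult_add_right)
    also have "\<dots> = pCons 0 (?p \<alpha> * ?p \<beta>) + (\<Sum>\<delta> = 1..M. smult (s \<delta>)
         ((\<Sum>i = 1..\<delta>. ?p (Suc \<alpha> - i) * ?p (\<beta> - (Suc \<delta> - i))) + ?p (\<alpha> - \<delta>) * ?p \<beta>))"
      using shift by simp
    also have "\<dots> = ?p (Suc \<alpha>) * ?p \<beta> + (\<Sum>\<delta> = 1..M. smult (s \<delta>)
         (\<Sum>i = 1..\<delta>. ?p (Suc \<alpha> - i) * ?p (\<beta> - (Suc \<delta> - i))))"
      using Suc.prems False
      by (simp add: flat_poly_Suc[of \<alpha> M] algebra_simps sum_distrib_left sum.distrib smult_add_right)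
    also have "\<dots> = ?p (\<alpha> + Suc \<beta> - 1)"
      using Suc.IH[of "Suc \<alpha>"] Suc.prems False by simp
    finally show ?thesis .
  qed
qed

text \<open>For monic \<open>f\<close> this is the sum of the residues of \<open>p / f\<close>, read
  off as the coefficient of \<open>1/x\<close> in the expansion at infinity.\<close>

definition residue_pairing :: "'a::field poly \<Rightarrow> 'a poly \<Rightarrow> 'a" where
  "residue_pairing f p = coeff (p mod f) (degree f - 1)"

lemma residue_pairing_add: "residue_pairing f (p + q) = residue_pairing f p + residue_pairing f q"
  by (simp add: residue_pairing_def poly_mod_add_left)

lemma residue_pairing_smult: "residue_pairing f (smult c p) = c * residue_pairing f p"
  by (simp add: residue_pairing_def mod_smult_left)

lemma residue_pairing_0 [simp]: "residue_pairing f 0 = 0"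
  by (simp add: residue_pairing_def)

lemma residue_pairing_sum: "residue_pairing f (\<Sum>i\<in>A. g i) = (\<Sum>i\<in>A. residue_pairing f (g i))"
  by (induction A rule: infinite_finite_induct) (simp_all add: residue_pairing_add)

text \<open>
  Induction on \<open>a\<close> by moving a factor \<open>x\<close> from \<open>\<phi>\<^sub>a\<close> to \<open>\<phi>\<^sub>b\<close>; the correction terms cancel because they
  depend on the indices only through \<open>a + b\<close>.
\<close>

lemma residue_pairing_flat_poly:
  assumes "a \<in> {1..N}" "b \<in> {1..N}"
  shows "residue_pairing (flat_poly s (Suc N)) (flat_poly s a * flat_poly s b) = of_bool (a + b = Suc N)"
  using assms
proof (induction a arbitrary: b rule: less_induct)
  case (less a)
  let ?p = "flat_poly s"
  let ?e = "residue_pairing (?p (Suc N))"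
  have top: "?e (?p c * ?p (Suc N)) = 0" for c
    by (simp add: residue_pairing_def)
  show ?case
  proof (cases "a = 1")
    case True
    obtain b' where b': "b = Suc b'" using less.prems by (cases b) auto
    \<comment> \<open>As \<open>\<phi>\<^sub>1 = 1\<close> and \<open>\<phi>\<^sub>b\<close> is
      reduced and monic of degree \<open>b - 1\<close>, its coefficient at \<open>N - 1\<close>
      detects \<open>b = N\<close>.\<close>
    have "?p b mod ?p (Suc N) = ?p b"
      using less.prems b' by (intro mod_poly_less) (simp add: degree_flat_poly)
    then show ?thesis
      using True less.prems b' coeff_flat_poly_ge[of b' "N - 1" s]
      by (auto simp: residue_pairing_def degree_flat_poly)
  next
    case False
    then obtain c where a: "a = Suc c" and c: "0 < c" "c < N"
      using less.prems by (cases a) auto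
    have IH: "?e (?p d * ?p d') = of_bool (d + d' = Suc N)"
      if "d \<le> c" "d \<in> {1..N}" "d' \<in> {1..N}" for d d'
      using that less.IH[of d d'] a by simp
    have IH0: "?e (?p d * ?p d') = of_bool (d + d' = Suc N \<and> 0 < d \<and> 0 < d')"
      if "d \<le> c" "d' \<le> N" for d d'
      using that c IH[of d d'] by (cases "d = 0 \<or> d' = 0") auto
    have "?p (Suc c) * ?p b + (\<Sum>\<gamma> = 1..N. smult (s \<gamma>) (?p c * ?p (b - \<gamma>)))
        = ?p c * ?p (Suc b) + (\<Sum>\<gamma> = 1..N. smult (s \<gamma>) (?p (c - \<gamma>) * ?p b))"
      using c less.prems
      by (simp add: flat_poly_Suc[of c N] flat_poly_Suc[of b N] algebra_simps
          sum_distrib_left sum_distrib_right)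
    from arg_cong[OF this, of ?e]
    have eq: "?e (?p a * ?p b) + (\<Sum>\<gamma> = 1..N. s \<gamma> * ?e (?p c * ?p (b - \<gamma>)))
        = ?e (?p c * ?p (Suc b)) + (\<Sum>\<gamma> = 1..N. s \<gamma> * ?e (?p (c - \<gamma>) * ?p b))"
      by (simp add: residue_pairing_add residue_pairing_sum residue_pairing_smult a)
    \<comment> \<open>If \<open>c + b - \<gamma> = N + 1\<close>, then \<open>c, b \<le> N\<close>
      force \<open>\<gamma> < b\<close> and \<open>\<gamma> < c\<close>, so the surviving terms have
      positive indices on both sides.\<close>
    have "(\<Sum>\<gamma> = 1..N. s \<gamma> * ?e (?p c * ?p (b - \<gamma>)))
        = (\<Sum>\<gamma> = 1..N. s \<gamma> * ?e (?p (c - \<gamma>) * ?p b))"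
      using c less.prems by (intro sum.cong refl) (auto simp: IH0)
    \<comment> \<open>For \<open>b = N\<close> the product is a multiple of the modulus and pairs to
      0, as it must since \<open>a > 1\<close>.\<close>
    moreover have "?e (?p c * ?p (Suc b)) = of_bool (a + b = Suc N)"
      using top[of c] c less.prems a IH[of c "Suc b"]
      by (cases "b = N") auto
    ultimately show ?thesis using eq by simp
  qed
qed

section \<open>The Jacobian ring\<close>

definition dLambda :: "nat \<Rightarrow> (nat \<Rightarrow> complex) \<Rightarrow> complex poly" where
  "dLambda N v = pderiv (monom (1 / of_nat (N + 1)) (N + 1) + (\<Sum>k = 1..N. monom (v k) (k - 1)))"

lemma scalar_mult_x_pow: "scalar c * x_pow n = [:monom c n:]"
  by (simp add: scalar_def x_pow_def smult_monom)

lemma const_poly_sum: "(\<Sum>i\<in>A. [:f i:]) = [:\<Sum>i\<in>A. f i:]"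
  by (induction A rule: infinite_finite_induct) simp_all

lemma unfolding_A_eq:
  "unfolding_A N v =
     pCons (monom (1 / of_nat (N + 1)) (N + 1) + (\<Sum>k = 1..N. monom (v k) (k - 1))) [:0, 1:]"
  unfolding unfolding_A_def scalar_mult_x_pow const_poly_sum
  by (simp add: monom_altdef numeral_2_eq_2 one_pCons)

lemma diff_x_unfolding: "diff_x (unfolding_A N v) = [:dLambda N v:]"
  unfolding unfolding_A_eq diff_x_def dLambda_def
  by (simp add: map_poly_pCons)

lemma diff_y_unfolding: "diff_y (unfolding_A N v) = [:0, 2:]"
  unfolding unfolding_A_eq diff_y_def
  by (simp add: pderiv_pCons)

text \<open>Since \<open>\<partial>\<Lambda>/\<partial>y = 2y\<close>, setting \<open>y = 0\<close>
  maps the Jacobian ideal onto the principal ideal of \<open>dLambda\<close>; all computations can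
  then be done in \<open>x\<close> alone.\<close>

lemma const_in_jacobian_ideal_iff: "[:p:] \<in> jacobian_ideal N v \<longleftrightarrow> dLambda N v dvd p"
proof
  assume "[:p:] \<in> jacobian_ideal N v"
  then obtain P Q where "[:p:] = P * [:dLambda N v:] + Q * [:0, 2:]"
    unfolding jacobian_ideal_def diff_x_unfolding diff_y_unfolding by blast
  then have "coeff [:p:] 0 = coeff (P * [:dLambda N v:] + Q * [:0, 2:]) 0"
    by simp
  then have "p = coeff P 0 * dLambda N v"
    by (simp add: coeff_mult)
  then show "dLambda N v dvd p" by simp
next
  assume "dLambda N v dvd p"
  then obtain q where "p = dLambda N v * q" by (auto simp: dvd_def)
  then have "[:p:] = [:q:] * [:dLambda N v:] + 0 * [:0, 2:]"
    by simp
  then show "[:p:] \<in> jacobian_ideal N v"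
    unfolding jacobian_ideal_def diff_x_unfolding diff_y_unfolding by blast
qed

lemma coeff_dLambda:
  "coeff (dLambda N v) c = of_bool (c = N) + (if c + 2 \<le> N then of_nat (c + 1) * v (c + 2) else 0)"
proof -
  have "(\<Sum>k = 1..N. coeff (monom (v k) (k - 1)) (Suc c)) = (\<Sum>k = 1..N. if k = c + 2 then v (c + 2) else 0)"
    by (intro sum.cong) auto
  also have "\<dots> = (if c + 2 \<le> N then v (c + 2) else 0)"
    by simp
  finally have "(\<Sum>k = 1..N. coeff (monom (v k) (k - 1)) (Suc c)) = (if c + 2 \<le> N then v (c + 2) else 0)" .
  then have "coeff (dLambda N v) c =
      of_nat (Suc c) * (of_bool (c = N) / of_nat (N + 1) + (if c + 2 \<le> N then v (c + 2) else 0))"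
    by (simp add: dLambda_def coeff_pderiv coeff_sum)
  then show ?thesis
    by (cases "c = N") (simp_all add: of_nat_neq_0 del: of_nat_Suc)
qed

lemma degree_dLambda: "degree (dLambda N v) = N"
  by (intro antisym degree_le le_degree) (simp_all add: coeff_dLambda)

text \<open>The Kodaira-Spencer map: \<open>\<partial>/\<partial>v\<^sub>a\<close> is represented by
  \<open>\<partial>\<Lambda>/\<partial>v\<^sub>a\<close>, the power of \<open>x\<close> with
  exponent \<open>a - 1\<close>.\<close>

definition tangent_poly :: "nat \<Rightarrow> (nat \<Rightarrow> complex) \<Rightarrow> complex poly" where
  "tangent_poly N X = (\<Sum>a = 1..N. monom (X a) (a - 1))"

lemma coeff_tangent_poly: "coeff (tangent_poly N X) c = (if c < N then X (Suc c) else 0)"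
proof -
  have "coeff (tangent_poly N X) c = (\<Sum>a = 1..N. if a = Suc c then X (Suc c) else 0)"
    unfolding tangent_poly_def coeff_sum by (intro sum.cong) auto
  then show ?thesis by simp
qed

lemma tangent_poly_coeff:
  assumes "degree p < N \<or> p = 0"
  shows "tangent_poly N (\<lambda>k. coeff p (k - 1)) = p"
  by (rule poly_eqI) (use assms in \<open>auto simp: coeff_tangent_poly coeff_eq_0\<close>)

text \<open>Existence and uniqueness of the basis expansion are those of the remainder modulo
  \<open>dLambda\<close>, which has degree \<open>N\<close>.\<close>

lemma struct_const_eq:
  assumes "N \<ge> 1" "k \<in> {1..N}"
  shows "struct_const N v a b k = coeff (monom 1 (a - 1 + (b - 1)) mod dLambda N v) (k - 1)"
proof -
  define f where "f = dLambda N v"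
  define p where "p = (monom 1 (a - 1 + (b - 1)) :: complex poly)"
  \<comment> \<open>The value 0 outside \<open>{1..N}\<close> matches the normalisation in the
    description of \<open>struct_const\<close>.\<close>
  define c where "c = (\<lambda>k. if k \<in> {1..N} then coeff (p mod f) (k - 1) else 0)"
  have f: "f \<noteq> 0" "degree f = N"
    using assms degree_dLambda[of N v] by (auto simp: f_def)
  have small: "degree (p mod f) < N \<or> p mod f = 0"
    using degree_mod_less[of f p] f by auto
  have mem: "x_pow (a - 1) * x_pow (b - 1) - (\<Sum>k = 1..N. scalar (d k) * x_pow (k - 1))
      \<in> jacobian_ideal N v \<longleftrightarrow> f dvd p - tangent_poly N d" for d
  proof -
    have "x_pow (a - 1) * x_pow (b - 1) - (\<Sum>k = 1..N. scalar (d k) * x_pow (k - 1))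
       = [:p - tangent_poly N d:]"
      unfolding scalar_mult_x_pow const_poly_sum
      by (simp add: p_def x_pow_def mult_monom tangent_poly_def add.commute)
    then show ?thesis
      by (simp add: const_in_jacobian_ideal_iff f_def)
  qed
  have deg: "tangent_poly N d mod f = tangent_poly N d" for d
  proof (rule mod_poly_less)
    have "degree (tangent_poly N d) \<le> N - 1"
      using assms by (intro degree_le) (auto simp: coeff_tangent_poly)
    then show "degree (tangent_poly N d) < degree f"
      using assms(1) f by linarith
  qed
  have "tangent_poly N c = tangent_poly N (\<lambda>k. coeff (p mod f) (k - 1))"
    unfolding tangent_poly_def by (intro sum.cong) (auto simp: c_def)
  then have tc: "tangent_poly N c = p mod f"
    using tangent_poly_coeff[OF small] by simp
  have "(THE d. (\<forall>k. k \<notin> {1..N} \<longrightarrow> d k = 0) \<and> f dvd p - tangent_poly N d) = c"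
  proof (rule the_equality)
    show "(\<forall>k. k \<notin> {1..N} \<longrightarrow> c k = 0) \<and> f dvd p - tangent_poly N c"
      unfolding tc by (simp add: c_def dvd_minus_mod)
  next
    fix d assume d: "(\<forall>k. k \<notin> {1..N} \<longrightarrow> d k = 0) \<and> f dvd p - tangent_poly N d"
    then have "p mod f = tangent_poly N d"
      using deg[of d] by (metis mod_eq_dvd_iff)
    then have e: "coeff (tangent_poly N d) n = coeff (tangent_poly N c) n" for n
      using tc by simp
    show "d = c"
    proof
      fix k
      show "d k = c k"
        using d e[of "k - 1"] by (cases k; cases "k \<in> {1..N}") (auto simp: coeff_tangent_poly c_def)
    qed
  qed
  then have "struct_const N v a b = c"
    unfolding struct_const_def mem .
  then show ?thesis using assms by (simp add: c_def p_def f_def)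
qed

lemma mod_sum_left: "(\<Sum>i\<in>A. g i) mod f = (\<Sum>i\<in>A. g i mod (f :: 'a::field poly))"
  by (induction A rule: infinite_finite_induct) (simp_all add: poly_mod_add_left)

lemma tangent_prod_eq:
  assumes "N \<ge> 1" "k \<in> {1..N}"
  shows "tangent_prod N v X Y k = coeff ((tangent_poly N X * tangent_poly N Y) mod dLambda N v) (k - 1)"
proof -
  have "tangent_poly N X * tangent_poly N Y =
    (\<Sum>a = 1..N. \<Sum>b = 1..N. smult (X a * Y b) (monom 1 (a - 1 + (b - 1))))"
    unfolding tangent_poly_def sum_product by (simp add: mult_monom smult_monom)
  then show ?thesis
    using assms
    by (simp add: tangent_prod_def struct_const_eq mod_sum_left mod_smult_left coeff_sum)
qed

text \<open>By definition the pairing is the \<open>N\<close>-th component of the product, hence the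
  top coefficient of a remainder.\<close>

lemma eta_eq:
  assumes "N \<ge> 1"
  shows "eta N v X Y = residue_pairing (dLambda N v) (tangent_poly N X * tangent_poly N Y)"
proof -
  have "eta N v X Y = tangent_prod N v X Y N"
    by (simp add: eta_def tangent_prod_def)
  then show ?thesis
    using assms by (simp add: tangent_prod_eq residue_pairing_def degree_dLambda)
qed

text \<open>The first product enters as its remainder, and reducing before the second multiplication
  does not change the class.\<close>

lemma eta_tangent_prod:
  assumes "N \<ge> 1"
  shows "eta N v (tangent_prod N v X Y) Z =
    residue_pairing (dLambda N v) (tangent_poly N X * tangent_poly N Y * tangent_poly N Z)"
proof -
  let ?f = "dLambda N v" and ?p = "tangent_poly N X * tangent_poly N Y"
  have "?f \<noteq> 0"
    using assms degree_dLambda[of N v] by auto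
  then have small: "degree (?p mod ?f) < N \<or> ?p mod ?f = 0"
    using degree_mod_less[of ?f ?p] by (auto simp: degree_dLambda)
  have "tangent_poly N (tangent_prod N v X Y) = tangent_poly N (\<lambda>k. coeff (?p mod ?f) (k - 1))"
    unfolding tangent_poly_def using assms
    by (intro sum.cong refl) (simp add: tangent_prod_eq tangent_poly_def)
  also have "\<dots> = ?p mod ?f"
    by (rule tangent_poly_coeff[OF small])
  finally show ?thesis
    using assms by (simp add: eta_eq residue_pairing_def mod_mult_left_eq)
qed

section \<open>Evaluation and partial derivatives\<close>

definition mono_eval :: "(nat \<Rightarrow> complex) \<Rightarrow> monomial \<Rightarrow> complex" where
  "mono_eval t a = (\<Prod>k\<in>Poly_Mapping.keys a. t k ^ Poly_Mapping.lookup a k)"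

lemma mono_eval_superset:
  assumes "finite A" "Poly_Mapping.keys a \<subseteq> A"
  shows "mono_eval t a = (\<Prod>k\<in>A. t k ^ Poly_Mapping.lookup a k)"
  unfolding mono_eval_def using assms
  by (intro prod.mono_neutral_left) (auto simp: in_keys_iff)

lemma mono_eval_0 [simp]: "mono_eval t 0 = 1"
  by (simp add: mono_eval_def)

lemma mono_eval_add: "mono_eval t (a + b) = mono_eval t a * mono_eval t b"
proof -
  let ?A = "Poly_Mapping.keys a \<union> Poly_Mapping.keys b"
  have "Poly_Mapping.keys (a + b) \<subseteq> ?A"
    by (rule Poly_Mapping.keys_add)
  then show ?thesis
    by (simp add: mono_eval_superset[of ?A] lookup_add power_add prod.distrib)
qed

lemma mono_eval_single [simp]: "mono_eval t (Poly_Mapping.single i n) = t i ^ n"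
  by (simp add: mono_eval_def)

lemma mpoly_eval_superset:
  assumes "finite A" "Poly_Mapping.keys p \<subseteq> A"
  shows "mpoly_eval p t = (\<Sum>a\<in>A. of_rat (Poly_Mapping.lookup p a) * mono_eval t a)"
  unfolding mpoly_eval_def mono_eval_def using assms
  by (intro sum.mono_neutral_left) (auto simp: in_keys_iff)

lemma mpoly_eval_0 [simp]: "mpoly_eval 0 t = 0"
  by (simp add: mpoly_eval_def)

lemma mpoly_eval_add: "mpoly_eval (p + q) t = mpoly_eval p t + mpoly_eval q t"
proof -
  let ?A = "Poly_Mapping.keys p \<union> Poly_Mapping.keys q"
  have "Poly_Mapping.keys (p + q) \<subseteq> ?A"
    by (rule Poly_Mapping.keys_add)
  then show ?thesis
    by (simp add: mpoly_eval_superset[of ?A] lookup_add of_rat_add sum.distrib ring_distribs)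
qed

lemma mpoly_eval_sum: "mpoly_eval (\<Sum>i\<in>A. f i) t = (\<Sum>i\<in>A. mpoly_eval (f i) t)"
  by (induction A rule: infinite_finite_induct) (simp_all add: mpoly_eval_add)

lemma mpoly_eval_single: "mpoly_eval (Poly_Mapping.single a c) t = of_rat c * mono_eval t a"
  by (simp add: mpoly_eval_superset[of "{a}"])

lemma mpoly_eval_pd_superset:
  assumes "finite A" "Poly_Mapping.keys p \<subseteq> A"
  shows "mpoly_eval (pd i p) t = (\<Sum>a\<in>A. of_rat (Poly_Mapping.lookup p a) *
    (of_nat (Poly_Mapping.lookup a i) * mono_eval t (a - Poly_Mapping.single i 1)))"
proof -
  have "mpoly_eval (pd i p) t = (\<Sum>a\<in>Poly_Mapping.keys p. of_rat (Poly_Mapping.lookup p a) *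
    (of_nat (Poly_Mapping.lookup a i) * mono_eval t (a - Poly_Mapping.single i 1)))"
    by (simp add: pd_def mpoly_eval_sum mpoly_eval_single of_rat_mult mult_ac)
  also have "\<dots> = (\<Sum>a\<in>A. of_rat (Poly_Mapping.lookup p a) *
    (of_nat (Poly_Mapping.lookup a i) * mono_eval t (a - Poly_Mapping.single i 1)))"
    using assms by (intro sum.mono_neutral_left) (auto simp: in_keys_iff)
  finally show ?thesis .
qed

section \<open>Formal and analytic partial derivatives\<close>

lemma minus_plus_single:
  "0 < Poly_Mapping.lookup a i \<Longrightarrow> a - Poly_Mapping.single i (1::nat) + Poly_Mapping.single i 1 = a"
  by (rule poly_mapping_eqI) (auto simp: lookup_add lookup_minus lookup_single when_def)

lemma mono_eval_has_derivative:
  "((\<lambda>u. mono_eval (t(i := u)) a) has_field_derivative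
     of_nat (Poly_Mapping.lookup a i) * mono_eval (t(i := u)) (a - Poly_Mapping.single i 1)) (at u)"
proof -
  let ?n = "Poly_Mapping.lookup a i"
  let ?A = "insert i (Poly_Mapping.keys a)"
  \<comment> \<open>\<open>R\<close> collects the factors in the other variables; it is common to
    the monomial and its derivative and does not depend on \<open>u\<close>.\<close>
  define R where "R = (\<Prod>k\<in>?A - {i}. t k ^ Poly_Mapping.lookup a k)"
  have split: "mono_eval (t(i := u)) b = u ^ Poly_Mapping.lookup b i * R"
    if "Poly_Mapping.keys b \<subseteq> ?A" "\<And>k. k \<noteq> i \<Longrightarrow> Poly_Mapping.lookup b k = Poly_Mapping.lookup a k" for b u
  proof -
    have "mono_eval (t(i := u)) b =
       (\<Prod>k\<in>?A. (t(i := u)) k ^ Poly_Mapping.lookup b k)"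
      using that by (intro mono_eval_superset) auto
    also have "\<dots> = u ^ Poly_Mapping.lookup b i *
       (\<Prod>k\<in>?A - {i}. (t(i := u)) k ^ Poly_Mapping.lookup b k)"
      by (subst prod.remove[of _ i]) auto
    also have "(\<Prod>k\<in>?A - {i}. (t(i := u)) k ^ Poly_Mapping.lookup b k) = R"
      unfolding R_def using that by (intro prod.cong) auto
    finally show ?thesis .
  qed
  have 1: "mono_eval (t(i := u)) a = u ^ ?n * R" for u
    by (rule split) auto
  have 2: "mono_eval (t(i := u)) (a - Poly_Mapping.single i 1) = u ^ (?n - 1) * R" for u
    by (subst split)
      (auto simp: lookup_minus lookup_single when_def in_keys_iff split: if_splits)
  show ?thesis
    unfolding 1 2 by (auto intro!: derivative_eq_intros)
qed

text \<open>Lets identities between values at all points \<open>t\<close> be differentiated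
  analytically, without lifting them to identities of polynomials.\<close>

lemma mpoly_eval_has_derivative:
  "((\<lambda>u. mpoly_eval p (t(i := u))) has_field_derivative mpoly_eval (pd i p) (t(i := u))) (at u)"
  unfolding mpoly_eval_pd_superset[OF finite_keys order_refl]
  unfolding mpoly_eval_superset[OF finite_keys[of p] order_refl]
  by (intro DERIV_sum DERIV_cmult mono_eval_has_derivative)

lemma lookup_pd:
  "Poly_Mapping.lookup (pd i p) b =
     of_nat (Suc (Poly_Mapping.lookup b i)) * Poly_Mapping.lookup p (b + Poly_Mapping.single i 1)"
proof -
  let ?c = "b + Poly_Mapping.single i (1::nat)"
  have "Poly_Mapping.lookup (pd i p) b = (\<Sum>a\<in>Poly_Mapping.keys p.
      (of_nat (Poly_Mapping.lookup a i) * Poly_Mapping.lookup p a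
        when a - Poly_Mapping.single i 1 = b))"
    by (simp add: pd_def lookup_sum lookup_single)
  also have "\<dots> = (\<Sum>a\<in>Poly_Mapping.keys p. if a = ?c
      then of_nat (Poly_Mapping.lookup a i) * Poly_Mapping.lookup p a else 0)"
  proof (intro sum.cong refl)
    fix a
    \<comment> \<open>If the exponent at \<open>i\<close> is 0, truncation may send \<open>a\<close>
      to \<open>b\<close>, but then the coefficient is 0.\<close>
    show "(of_nat (Poly_Mapping.lookup a i) * Poly_Mapping.lookup p a
        when a - Poly_Mapping.single i 1 = b) = (if a = ?c
      then of_nat (Poly_Mapping.lookup a i) * Poly_Mapping.lookup p a else 0)"
      using minus_plus_single[of a i]
      by (cases "Poly_Mapping.lookup a i = 0") (auto simp: when_def lookup_add lookup_single)
  qed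
  also have "\<dots> = of_nat (Suc (Poly_Mapping.lookup b i)) * Poly_Mapping.lookup p ?c"
    by (simp add: in_keys_iff lookup_add lookup_single)
  finally show ?thesis .
qed

lemma pd_commute: "pd i (pd j p) = pd j (pd i p)"
  by (rule poly_mapping_eqI) (simp add: lookup_pd lookup_add lookup_single when_def add_ac)

lemma pd_0 [simp]: "pd i 0 = 0"
  by (simp add: pd_def)

lemma pd_foldr_commute: "pd i (foldr (\<lambda>j. pd (f j)) L p) = foldr (\<lambda>j. pd (f j)) L (pd i p)"
  by (induction L) (simp_all add: pd_commute[of i])

section \<open>Flat coordinates\<close>

text \<open>The variable \<open>t\<^sub>k\<close> has weight \<open>N + 2 - k\<close>. The total
  weight is left free because removing a variable lowers it.\<close>

definition weight_exponents :: "nat \<Rightarrow> nat \<Rightarrow> monomial set" where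
  "weight_exponents N n =
     {a. Poly_Mapping.keys a \<subseteq> {1..N} \<and> (\<Sum>k = 1..N. (N + 2 - k) * Poly_Mapping.lookup a k) = n}"

lemma flat_exponents_eq: "flat_exponents N g = weight_exponents N (N + 2 - g)"
  by (simp add: flat_exponents_def weight_exponents_def)

lemma finite_weight_exponents: "n \<le> N + 2 \<Longrightarrow> finite (weight_exponents N n)"
  using finite_flat_exponents[of N "N + 2 - n"] by (simp add: flat_exponents_eq)

text \<open>For \<open>a\<close> supported in \<open>{1..N}\<close>, the number of words with
  \<open>c\<close> letters \<open>x\<close> and, for each \<open>k\<close>,
  \<open>lookup a k\<close> letters \<open>t\<^sub>k\<close>.\<close>

definition multinom :: "nat \<Rightarrow> nat \<Rightarrow> monomial \<Rightarrow> complex" where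
  "multinom N c a = fact (mono_degree a + c) / (fact c * (\<Prod>k = 1..N. fact (Poly_Mapping.lookup a k)))"

section \<open>Degrees of monomials and Pascal's rule\<close>

lemma mono_degree_superset:
  assumes "finite A" "Poly_Mapping.keys a \<subseteq> A"
  shows "mono_degree a = (\<Sum>k\<in>A. Poly_Mapping.lookup a k)"
  unfolding mono_degree_def using assms
  by (intro sum.mono_neutral_left) (auto simp: in_keys_iff)

lemma mono_degree_add: "mono_degree (a + b) = mono_degree a + mono_degree b"
proof -
  let ?A = "Poly_Mapping.keys a \<union> Poly_Mapping.keys b"
  have "Poly_Mapping.keys (a + b) \<subseteq> ?A"
    by (rule Poly_Mapping.keys_add)
  then show ?thesis
    by (simp add: mono_degree_superset[of ?A] lookup_add sum.distrib)
qed

lemma mono_degree_single [simp]: "mono_degree (Poly_Mapping.single k n) = n"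
  by (simp add: mono_degree_def)

lemma mono_degree_eq_0_iff: "mono_degree a = 0 \<longleftrightarrow> a = 0"
  by (auto simp: mono_degree_def in_keys_iff intro: poly_mapping_eqI)

lemma prod_fact_add_single:
  fixes a :: monomial
  assumes "k \<in> {1..N}"
  shows "(\<Prod>j = 1..N. fact (Poly_Mapping.lookup (a + Poly_Mapping.single k 1) j)) =
    of_nat (Suc (Poly_Mapping.lookup a k)) *
      (\<Prod>j = 1..N. fact (Poly_Mapping.lookup a j) :: 'a::field_char_0)"
proof -
  have "(\<Prod>j\<in>{1..N} - {k}. fact (Poly_Mapping.lookup (a + Poly_Mapping.single k 1) j) :: 'a)
      = (\<Prod>j\<in>{1..N} - {k}. fact (Poly_Mapping.lookup a j))"
    by (intro prod.cong) (auto simp: lookup_add lookup_single)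
  then show ?thesis
    unfolding prod.remove[OF finite_atLeastAtMost assms]
    by (simp add: lookup_add lookup_single mult.assoc)
qed

lemma multinom_add_single:
  assumes "k \<in> {1..N}"
  shows "multinom N c (a + Poly_Mapping.single k 1) * of_nat (Suc (Poly_Mapping.lookup a k)) =
    multinom N c a * of_nat (Suc (mono_degree a + c))"
proof -
  have "x * F / (C * (s * P)) * s = F / (C * P) * x" if "s \<noteq> 0" for x F C s P :: complex
    using that by (simp add: field_simps)
  moreover have "mono_degree a + mono_degree (Poly_Mapping.single k 1) + c = Suc (mono_degree a + c)"
    by simp
  ultimately show ?thesis
    unfolding multinom_def prod_fact_add_single[OF assms] mono_degree_add
    by (simp only: fact_Suc) (metis of_nat_neq_0)
qed

text \<open>Words are sorted by their first letter; \<open>of_bool (a = 0)\<close> accounts for the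
  empty word. After multiplication by the word length \<open>?m\<close>, each letter contributes in
  proportion to its multiplicity.\<close>

lemma multinom_pascal:
  assumes "Poly_Mapping.keys a \<subseteq> {1..N}"
  shows "multinom N c a = (if c = 0 then of_bool (a = 0) else multinom N (c - 1) a) +
    (\<Sum>k = 1..N. if Poly_Mapping.lookup a k = 0 then 0 else multinom N c (a - Poly_Mapping.single k 1))"
proof (cases "a = 0 \<and> c = 0")
  case True
  then show ?thesis by (simp add: multinom_def mono_degree_def)
next
  case False
  let ?m = "mono_degree a + c"
  have m: "(of_nat ?m :: complex) \<noteq> 0"
    using False by (simp only: of_nat_eq_0_iff) (auto simp: mono_degree_eq_0_iff)
  have "(if Poly_Mapping.lookup a k = 0 then 0 else multinom N c (a - Poly_Mapping.single k 1)) * of_nat ?m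
      = multinom N c a * of_nat (Poly_Mapping.lookup a k)" if "k \<in> {1..N}" for k
  proof (cases "Poly_Mapping.lookup a k = 0")
    case ne: False
    define b where "b = a - Poly_Mapping.single k (1::nat)"
    have "a = b + Poly_Mapping.single k 1"
      using ne minus_plus_single[of a k] by (simp add: b_def)
    then show ?thesis
      using multinom_add_single[OF that, of c b] ne
      by (simp add: lookup_add lookup_single mono_degree_add)
  qed simp
  then have "(\<Sum>k = 1..N. if Poly_Mapping.lookup a k = 0 then 0 else multinom N c (a - Poly_Mapping.single k 1)) * of_nat ?m
      = (\<Sum>k = 1..N. multinom N c a * of_nat (Poly_Mapping.lookup a k))"
    unfolding sum_distrib_right by (intro sum.cong) auto
  also have "\<dots> = multinom N c a * of_nat (mono_degree a)"
    by (simp add: mono_degree_superset[OF _ assms] sum_distrib_left)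
  moreover have "(if c = 0 then of_bool (a = 0) else multinom N (c - 1) a) * of_nat ?m = multinom N c a * of_nat c"
  proof (cases c)
    case 0
    then show ?thesis using False by simp
  next
    case (Suc d)
    have "(fact (mono_degree a + Suc d) :: complex) = of_nat (mono_degree a + Suc d) * fact (mono_degree a + d)"
      and "(fact (Suc d) :: complex) = of_nat (Suc d) * fact d"
      by simp_all
    then show ?thesis
      using Suc by (simp add: multinom_def field_simps del: of_nat_Suc of_nat_add fact_Suc)
  qed
  ultimately have "((if c = 0 then of_bool (a = 0) else multinom N (c - 1) a) +
    (\<Sum>k = 1..N. if Poly_Mapping.lookup a k = 0 then 0 else multinom N c (a - Poly_Mapping.single k 1))) * of_nat ?m
     = multinom N c a * of_nat c + multinom N c a * of_nat (mono_degree a)"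
    by (simp only: distrib_right)
  also have "\<dots> = multinom N c a * of_nat ?m"
    by (simp add: algebra_simps)
  finally have "((if c = 0 then of_bool (a = 0) else multinom N (c - 1) a) +
    (\<Sum>k = 1..N. if Poly_Mapping.lookup a k = 0 then 0 else multinom N c (a - Poly_Mapping.single k 1))) * of_nat ?m
     = multinom N c a * of_nat ?m" .
  from mult_right_cancel[OF m, THEN iffD1, OF this] show ?thesis ..
qed

lemma weight_add_single:
  assumes "k \<in> {1..N}"
  shows "a + Poly_Mapping.single k 1 \<in> weight_exponents N n \<longleftrightarrow>
    N + 2 - k \<le> n \<and> a \<in> weight_exponents N (n - (N + 2 - k))"
proof -
  have "(\<Sum>j = 1..N. (N + 2 - j) * Poly_Mapping.lookup (a + Poly_Mapping.single k 1) j)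
      = (\<Sum>j = 1..N. (N + 2 - j) * Poly_Mapping.lookup a j) + (\<Sum>j = 1..N. if j = k then N + 2 - k else 0)"
    unfolding sum.distrib[symmetric] by (intro sum.cong) (auto simp: lookup_add lookup_single)
  moreover have "Poly_Mapping.keys (a + Poly_Mapping.single k 1) = insert k (Poly_Mapping.keys a)"
    by (auto simp: in_keys_iff lookup_add lookup_single when_def split: if_splits)
  ultimately show ?thesis
    using assms by (auto simp: weight_exponents_def)
qed

text \<open>Removing one factor \<open>t\<^sub>k\<close> is a bijection from the exponents of weight
  \<open>n\<close> that contain it onto those of weight smaller by \<open>N + 2 - k\<close>.\<close>

lemma sum_weight_exponents_shift:
  fixes f :: "monomial \<Rightarrow> complex"
  assumes "k \<in> {1..N}" "n \<le> N + 2"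
  shows "(\<Sum>a\<in>weight_exponents N n. if Poly_Mapping.lookup a k = 0 then 0 else f (a - Poly_Mapping.single k 1))
    = (if N + 2 - k \<le> n then \<Sum>a\<in>weight_exponents N (n - (N + 2 - k)). f a else 0)"
proof -
  let ?e = "Poly_Mapping.single k (1::nat)"
  let ?A = "{a \<in> weight_exponents N n. Poly_Mapping.lookup a k \<noteq> 0}"
  let ?B = "if N + 2 - k \<le> n then weight_exponents N (n - (N + 2 - k)) else {}"
  have A: "a - ?e \<in> ?B \<and> a - ?e + ?e = a" if "a \<in> ?A" for a
    using that assms minus_plus_single[of a k] weight_add_single[of k N "a - ?e" n] by auto
  have "(\<Sum>a\<in>weight_exponents N n. if Poly_Mapping.lookup a k = 0 then 0 else f (a - ?e))
     = (\<Sum>a\<in>?A. f (a - ?e))"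
    using finite_weight_exponents[OF assms(2)]
    by (intro sum.mono_neutral_cong_right) auto
  also have "\<dots> = (\<Sum>a\<in>?B. f a)"
  proof (rule sum.reindex_bij_witness[of _ "\<lambda>a. a + ?e" "\<lambda>a. a - ?e"])
    fix b assume "b \<in> ?B"
    then show "b + ?e \<in> ?A"
      using assms weight_add_single[of k N b n]
      by (auto simp: lookup_add lookup_single split: if_splits)
    show "b + ?e - ?e = b" by simp
  next
    fix a assume "a \<in> ?A"
    from A[OF this] show "a - ?e \<in> ?B" "a - ?e + ?e = a" by blast+
  qed simp
  finally show ?thesis by simp
qed

text \<open>The coefficient of \<open>x^c\<close> in the generating polynomial of index
  \<open>n + c + 1\<close>, from expanding \<open>1/(X(k) - x)\<close> as a geometric series whose
  letters are \<open>x/k\<close> and \<open>s\<^sub>\<gamma> / k^(\<gamma>+1)\<close>.\<close>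

definition multinom_sum :: "nat \<Rightarrow> (nat \<Rightarrow> complex) \<Rightarrow> nat \<Rightarrow> nat \<Rightarrow> complex" where
  "multinom_sum N t c n = (\<Sum>a\<in>weight_exponents N n. multinom N c a * mono_eval t a)"

text \<open>Pascal's rule summed over a weight class. With \<open>k = N + 1 - \<gamma>\<close>, the
  removed variable has weight \<open>\<gamma> + 1\<close>.\<close>

lemma multinom_sum_rec:
  assumes "n \<le> N + 2"
  shows "multinom_sum N t c n = (if c = 0 then of_bool (n = 0) else multinom_sum N t (c - 1) n) +
    (\<Sum>\<gamma> = 1..N. if Suc \<gamma> \<le> n then t (N + 1 - \<gamma>) * multinom_sum N t c (n - Suc \<gamma>) else 0)"
proof -
  let ?E = "weight_exponents N n"
  have fin: "finite ?E" using assms by (rule finite_weight_exponents)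
  have zero: "(\<Sum>a\<in>?E. of_bool (a = 0) * mono_eval t a) = of_bool (n = 0)"
  proof -
    have "(\<Sum>a\<in>?E. of_bool (a = 0) * mono_eval t a) = (\<Sum>a\<in>?E. if a = 0 then 1 else 0)"
      by (intro sum.cong) auto
    also have "\<dots> = of_bool (n = 0)"
      using fin by (auto simp: weight_exponents_def)
    finally show ?thesis .
  qed
  have "multinom_sum N t c n = (\<Sum>a\<in>?E. (if c = 0 then of_bool (a = 0) else multinom N (c - 1) a) * mono_eval t a
     + (\<Sum>k = 1..N. if Poly_Mapping.lookup a k = 0 then 0
          else t k * (multinom N c (a - Poly_Mapping.single k 1) * mono_eval t (a - Poly_Mapping.single k 1))))"
    unfolding multinom_sum_def
  proof (intro sum.cong refl)
    fix a assume a: "a \<in> ?E"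
    have m: "mono_eval t a = t k * mono_eval t (a - Poly_Mapping.single k 1)"
      if "Poly_Mapping.lookup a k \<noteq> 0" for k
      using that minus_plus_single[of a k] mono_eval_add[of t "a - Poly_Mapping.single k 1" "Poly_Mapping.single k 1"]
      by simp
    have "(\<Sum>k = 1..N. if Poly_Mapping.lookup a k = 0 then 0 else multinom N c (a - Poly_Mapping.single k 1)) * mono_eval t a
       = (\<Sum>k = 1..N. if Poly_Mapping.lookup a k = 0 then 0
          else t k * (multinom N c (a - Poly_Mapping.single k 1) * mono_eval t (a - Poly_Mapping.single k 1)))"
      unfolding sum_distrib_right by (intro sum.cong refl) (simp add: m)
    then show "multinom N c a * mono_eval t a = (if c = 0 then of_bool (a = 0) else multinom N (c - 1) a) * mono_eval t a
     + (\<Sum>k = 1..N. if Poly_Mapping.lookup a k = 0 then 0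
          else t k * (multinom N c (a - Poly_Mapping.single k 1) * mono_eval t (a - Poly_Mapping.single k 1)))"
      using a multinom_pascal[of a N c] by (simp add: weight_exponents_def ring_distribs)
  qed
  also have "\<dots> = (if c = 0 then of_bool (n = 0) else multinom_sum N t (c - 1) n) +
     (\<Sum>k = 1..N. if N + 2 - k \<le> n then t k * multinom_sum N t c (n - (N + 2 - k)) else 0)"
  proof -
    have "(\<Sum>a\<in>?E. \<Sum>k = 1..N. if Poly_Mapping.lookup a k = 0 then 0
          else t k * (multinom N c (a - Poly_Mapping.single k 1) * mono_eval t (a - Poly_Mapping.single k 1)))
      = (\<Sum>k = 1..N. if N + 2 - k \<le> n then t k * multinom_sum N t c (n - (N + 2 - k)) else 0)"
      using assms
      by (subst sum.swap, intro sum.cong refl, subst sum_weight_exponents_shift)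
        (auto simp: multinom_sum_def sum_distrib_left)
    then show ?thesis
      using zero by (simp add: sum.distrib multinom_sum_def)
  qed
  also have "(\<Sum>k = 1..N. if N + 2 - k \<le> n then t k * multinom_sum N t c (n - (N + 2 - k)) else 0)
     = (\<Sum>\<gamma> = 1..N. if Suc \<gamma> \<le> n then t (N + 1 - \<gamma>) * multinom_sum N t c (n - Suc \<gamma>) else 0)"
    by (intro sum.reindex_bij_witness[of _ "\<lambda>\<gamma>. N + 1 - \<gamma>" "\<lambda>k. N + 1 - k"]) (auto simp: Suc_diff_le)
  finally show ?thesis .
qed

text \<open>Every variable has weight at least 2. This matches the missing term of degree
  \<open>N - 1\<close> in \<open>dLambda\<close>.\<close>

lemma multinom_sum_1: "multinom_sum N t c 1 = 0"
proof (induction c)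
  case 0
  show ?case using multinom_sum_rec[of 1 N t 0] by simp
next
  case (Suc c)
  then show ?case using multinom_sum_rec[of 1 N t "Suc c"] by simp
qed

text \<open>These are the \<open>s\<^sub>\<gamma>\<close>. The cut-off is needed because the sum in
  \<open>flat_poly\<close> may run past \<open>N\<close>.\<close>

definition dual_coord :: "nat \<Rightarrow> (nat \<Rightarrow> complex) \<Rightarrow> nat \<Rightarrow> complex" where
  "dual_coord N t \<gamma> = (if \<gamma> \<in> {1..N} then t (N + 1 - \<gamma>) else 0)"

text \<open>Extracting the coefficient of \<open>x^c\<close> turns the recursion of
  \<open>flat_poly\<close> into \<open>multinom_sum_rec\<close>; the bound on \<open>n\<close> keeps
  the weight \<open>n - c\<close> within its range.\<close>

lemma coeff_flat_poly:
  "n \<le> N + 1 \<Longrightarrow> coeff (flat_poly (dual_coord N t) (Suc n)) c = (if c \<le> n then multinom_sum N t c (n - c) else 0)"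
proof (induction n arbitrary: c rule: less_induct)
  case (less n)
  show ?case
  proof (cases "c \<le> n")
    case False
    then show ?thesis by (simp add: coeff_flat_poly_ge)
  next
    case True
    let ?p = "flat_poly (dual_coord N t)"
    have low: "coeff (?p m) d = (if d < m then multinom_sum N t d (m - 1 - d) else 0)" if "m \<le> n" for m d
      using that less.IH[of "m - 1" d] less.prems by (cases m) (auto simp: less_Suc_eq_le)
    have "(\<Sum>\<gamma> = 1..n. dual_coord N t \<gamma> * coeff (?p (n - \<gamma>)) c)
        = (\<Sum>\<gamma> = 1..N. if Suc \<gamma> \<le> n - c then t (N + 1 - \<gamma>) * multinom_sum N t c (n - c - Suc \<gamma>) else 0)"
    \<comment> \<open>Extra terms vanish on both sides: for \<open>\<gamma> > n\<close> by the case
      distinction, for \<open>\<gamma> > N\<close> by the cut-off in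
      \<open>dual_coord\<close>.\<close>
    proof (rule sum.mono_neutral_cong)
      fix \<gamma> assume "\<gamma> \<in> {1..N} - {1..n}"
      then show "(if Suc \<gamma> \<le> n - c then t (N + 1 - \<gamma>) * multinom_sum N t c (n - c - Suc \<gamma>) else 0) = 0"
        by auto
    next
      fix \<gamma> assume "\<gamma> \<in> {1..n} \<inter> {1..N}"
      moreover from this have "n - \<gamma> - 1 - c = n - c - Suc \<gamma>" by simp
      ultimately show "dual_coord N t \<gamma> * coeff (?p (n - \<gamma>)) c
          = (if Suc \<gamma> \<le> n - c then t (N + 1 - \<gamma>) * multinom_sum N t c (n - c - Suc \<gamma>) else 0)"
        by (auto simp: low dual_coord_def)
    qed (auto simp: dual_coord_def)
    moreover have "coeff (of_bool (n = 0) + pCons 0 (?p n)) c =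
        (if c = 0 then of_bool (n - c = 0) else multinom_sum N t (c - 1) (n - c))"
      using True by (cases c; cases n) (auto simp: low)
    ultimately show ?thesis
      using True less.prems
      by (subst multinom_sum_rec) (simp_all add: flat_poly.simps(2)[of _ n] coeff_sum)
  qed
qed

section \<open>The coordinate change and its derivatives\<close>

lemma lookup_v_poly:
  assumes "a \<in> flat_exponents N g"
  shows "Poly_Mapping.lookup (v_poly N g) a = fact (mono_degree a + g - 2) / fact (g - 1)
             * (\<Prod>k = 1..N. 1 / fact (Poly_Mapping.lookup a k))"
proof -
  have "Poly_Mapping.lookup (v_poly N g) a = (\<Sum>b\<in>flat_exponents N g.
     if b = a then fact (mono_degree a + g - 2) / fact (g - 1)
             * (\<Prod>k = 1..N. 1 / fact (Poly_Mapping.lookup a k)) else 0)"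
    unfolding v_poly_def lookup_sum by (intro sum.cong) (auto simp: lookup_single when_def)
  then show ?thesis using assms by (simp add: finite_flat_exponents)
qed

lemma keys_v_poly: "Poly_Mapping.keys (v_poly N g) \<subseteq> flat_exponents N g"
proof
  fix a assume "a \<in> Poly_Mapping.keys (v_poly N g)"
  then have "(\<Sum>b\<in>flat_exponents N g. Poly_Mapping.lookup (Poly_Mapping.single b
          (fact (mono_degree b + g - 2) / fact (g - 1)
             * (\<Prod>k = 1..N. 1 / fact (Poly_Mapping.lookup b k)) :: rat)) a) \<noteq> 0"
    by (simp add: in_keys_iff v_poly_def lookup_sum)
  then obtain b where "b \<in> flat_exponents N g" "b = a"
    by (elim sum.not_neutral_contains_not_neutral) (auto simp: lookup_single when_def split: if_splits)
  then show "a \<in> flat_exponents N g" by simp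
qed

lemma of_rat_fact [simp]: "of_rat (fact n) = (fact n :: 'a::field_char_0)"
  by (metis of_nat_fact of_rat_of_nat_eq)

text \<open>The left side is a coefficient of \<open>\<partial>\<Lambda>/\<partial>x\<close>. The
  factor \<open>c + 1\<close> turns \<open>(c + 1)!\<close> in the denominator into
  \<open>c!\<close>, giving the multinomial coefficient.\<close>

lemma v_of_eq:
  assumes "c + 2 \<le> N"
  shows "of_nat (c + 1) * v_of N t (c + 2) = multinom_sum N t c (N - c)"
proof -
  have "of_nat (c + 1) * v_of N t (c + 2) = (\<Sum>a\<in>flat_exponents N (c + 2).
     of_nat (c + 1) * (fact (mono_degree a + c) / fact (c + 1)
        * (\<Prod>k = 1..N. 1 / fact (Poly_Mapping.lookup a k))) * mono_eval t a)"
    unfolding v_of_def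
    by (subst mpoly_eval_superset[OF finite_flat_exponents keys_v_poly])
      (simp add: lookup_v_poly sum_distrib_left of_rat_mult of_rat_divide of_rat_prod mult.assoc del: fact_Suc)
  also have "\<dots> = (\<Sum>a\<in>flat_exponents N (c + 2). multinom N c a * mono_eval t a)"
    by (intro sum.cong refl) (simp add: multinom_def prod_dividef field_simps del: of_nat_Suc)
  finally show ?thesis
    by (simp add: multinom_sum_def flat_exponents_eq)
qed

text \<open>Differentiation lowers one exponent, so \<open>|a| + g - 2\<close> becomes
  \<open>|b| + g - 1\<close> and the coefficient is multinomial with \<open>c = g - 1\<close>. The
  weight drops from \<open>N + 2 - g\<close> to \<open>\<alpha> - g\<close>.\<close>

lemma flat_field_eq:
  assumes "\<alpha> \<in> {1..N}" "g \<in> {1..N}"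
  shows "flat_field N t \<alpha> g = (if g \<le> \<alpha> then multinom_sum N t (g - 1) (\<alpha> - g) else 0)"
proof -
  let ?e = "Poly_Mapping.single \<alpha> (1::nat)"
  have "flat_field N t \<alpha> g = (\<Sum>a\<in>flat_exponents N g. of_rat (Poly_Mapping.lookup (v_poly N g) a) *
       (of_nat (Poly_Mapping.lookup a \<alpha>) * mono_eval t (a - ?e)))"
    unfolding flat_field_def by (rule mpoly_eval_pd_superset[OF finite_flat_exponents keys_v_poly])
  also have "\<dots> = (\<Sum>a\<in>flat_exponents N g. if Poly_Mapping.lookup a \<alpha> = 0 then 0
       else multinom N (g - 1) (a - ?e) * mono_eval t (a - ?e))"
  proof (intro sum.cong refl)
    fix a assume a: "a \<in> flat_exponents N g"
    show "of_rat (Poly_Mapping.lookup (v_poly N g) a) *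
       (of_nat (Poly_Mapping.lookup a \<alpha>) * mono_eval t (a - ?e)) = (if Poly_Mapping.lookup a \<alpha> = 0 then 0
       else multinom N (g - 1) (a - ?e) * mono_eval t (a - ?e))"
    proof (cases "Poly_Mapping.lookup a \<alpha> = 0")
      case False
      define b where "b = a - ?e"
      have ab: "a = b + ?e"
        using False minus_plus_single[of a \<alpha>] by (simp add: b_def)
      have "of_rat (Poly_Mapping.lookup (v_poly N g) a) = fact (mono_degree b + (g - 1)) / fact (g - 1)
             / (of_nat (Suc (Poly_Mapping.lookup b \<alpha>)) * (\<Prod>k = 1..N. fact (Poly_Mapping.lookup b k) :: complex))"
        using a assms prod_fact_add_single[of \<alpha> N b, where 'a = complex] unfolding ab
        by (simp add: lookup_v_poly of_rat_mult of_rat_divide of_rat_prod prod_dividef mono_degree_add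
            del: of_nat_Suc)
      then have "of_rat (Poly_Mapping.lookup (v_poly N g) a) * of_nat (Poly_Mapping.lookup a \<alpha>) = multinom N (g - 1) b"
        by (simp add: ab lookup_add lookup_single multinom_def field_simps del: of_nat_Suc)
      then show ?thesis
        using False by (simp add: b_def mult.assoc[symmetric])
    qed simp
  qed
  also have "\<dots> = (if N + 2 - \<alpha> \<le> N + 2 - g
      then multinom_sum N t (g - 1) (N + 2 - g - (N + 2 - \<alpha>)) else 0)"
    using assms unfolding flat_exponents_eq multinom_sum_def
    by (subst sum_weight_exponents_shift) auto
  also have "\<dots> = (if g \<le> \<alpha> then multinom_sum N t (g - 1) (\<alpha> - g) else 0)"
    using assms by (auto intro: arg_cong[where f = "multinom_sum N t (g - 1)"])
  finally show ?thesis .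
qed

lemma tangent_poly_flat_field:
  assumes "\<alpha> \<in> {1..N}"
  shows "tangent_poly N (flat_field N t \<alpha>) = flat_poly (dual_coord N t) \<alpha>"
proof (rule poly_eqI)
  fix c
  obtain n where n: "\<alpha> = Suc n" using assms by (cases \<alpha>) auto
  show "coeff (tangent_poly N (flat_field N t \<alpha>)) c = coeff (flat_poly (dual_coord N t) \<alpha>) c"
    using assms n by (auto simp: coeff_tangent_poly flat_field_eq coeff_flat_poly)
qed

lemma dLambda_flat:
  assumes "N \<ge> 1"
  shows "dLambda N (v_of N t) = flat_poly (dual_coord N t) (Suc N)"
proof (rule poly_eqI)
  fix c
  \<comment> \<open>Below degree \<open>N - 1\<close> the coordinate formula applies; at
    \<open>N - 1\<close> both coefficients are 0; from \<open>N\<close> on both polynomials are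
    monic of degree \<open>N\<close>.\<close>
  consider "c + 2 \<le> N" | "c = N - 1" | "c \<ge> N" using assms by linarith
  then show "coeff (dLambda N (v_of N t)) c = coeff (flat_poly (dual_coord N t) (Suc N)) c"
  proof cases
    case 1
    then show ?thesis
      using v_of_eq[OF 1, of t] by (simp add: coeff_dLambda coeff_flat_poly)
  next
    case 2
    then show ?thesis
      using assms multinom_sum_1[of N t c] by (auto simp: coeff_dLambda coeff_flat_poly)
  next
    case 3
    then show ?thesis
      by (simp add: coeff_dLambda coeff_flat_poly_ge)
  qed
qed

section \<open>The counting recursion\<close>

lemma finite_P_hat_set:
  "finite {(is, js). length is = n \<and> length js = n \<and> P is js \<and>
     sum_list is = a \<and> sum_list js = b}"
  for a b :: nat
proof -
  let ?L = "\<lambda>c::nat. {xs. set xs \<subseteq> {..c} \<and> length xs = n}"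
  have "finite (?L a \<times> ?L b)"
    by (simp add: finite_lists_length_eq)
  then show ?thesis
    by (rule rev_finite_subset) (auto dest: member_le_sum_list)
qed

text \<open>A non-empty tuple of positive entries has positive sum. Truncated indices in the
  recursions therefore contribute nothing.\<close>

lemma P_hat_0: "\<gamma>s \<noteq> [] \<Longrightarrow> P_hat 0 b \<gamma>s = 0" "\<gamma>s \<noteq> [] \<Longrightarrow> P_hat a 0 \<gamma>s = 0"
  by (auto simp: P_hat_def card_eq_0_iff sum_list_eq_0_iff in_set_conv_nth neq_Nil_conv)
    (metis length_Cons nth_Cons_0 zero_less_Suc nth_mem less_numeral_extra(3))+

lemma P_hat_singleton: "P_hat a b [\<gamma>] = of_bool (0 < a \<and> 0 < b \<and> a + b = \<gamma> + 1)"
proof -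
  have "{(is, js). length is = length [\<gamma>] \<and> length js = length [\<gamma>] \<and>
        (\<forall>k < length [\<gamma>]. is ! k > 0 \<and> js ! k > 0 \<and> is ! k + js ! k = [\<gamma>] ! k + 1) \<and>
        sum_list is = a \<and> sum_list js = b} =
      (if 0 < a \<and> 0 < b \<and> a + b = \<gamma> + 1 then {([a], [b])} else {})"
    by (auto simp: length_Suc_conv)
  then show ?thesis by (simp add: P_hat_def)
qed

text \<open>The first pair of entries is \<open>(i, Suc \<delta> - i)\<close>, and removing it is a
  bijection for each \<open>i\<close>.\<close>

lemma P_hat_Cons:
  assumes "\<gamma>s \<noteq> []"
  shows "P_hat a b (\<delta> # \<gamma>s) = (\<Sum>i = 1..\<delta>. P_hat (a - i) (b - (Suc \<delta> - i)) \<gamma>s)"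
proof -
  define S where "S = (\<lambda>a b \<gamma>s. {(is, js). length is = length \<gamma>s \<and> length js = length \<gamma>s \<and>
        (\<forall>k < length \<gamma>s. is ! k > 0 \<and> js ! k > 0 \<and> is ! k + js ! k = \<gamma>s ! k + 1) \<and>
        sum_list is = a \<and> sum_list js = (b::nat)})"
  have P: "P_hat a b \<gamma>s = card (S a b \<gamma>s)" for a b \<gamma>s
    by (simp add: P_hat_def S_def)
  have fin: "finite (S a b \<gamma>s)" for a b \<gamma>s
    unfolding S_def by (rule finite_P_hat_set)
  \<comment> \<open>The remaining tuples are non-empty, so their sums are positive and the
    differences \<open>a - i\<close> and \<open>b - (Suc \<delta> - i)\<close> are not
    truncated.\<close>
  have pos: "0 < a \<and> 0 < b" if "(is, js) \<in> S a b \<gamma>s" for "is" js a b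
    using that assms P_hat_0[of \<gamma>s] fin unfolding P by (metis card_eq_0_iff empty_iff gr0I)
  have "bij_betw (\<lambda>(i, is, js). (i # is, (Suc \<delta> - i) # js))
      (SIGMA i:{1..\<delta>}. S (a - i) (b - (Suc \<delta> - i)) \<gamma>s) (S a b (\<delta> # \<gamma>s))"
  proof (intro bij_betw_byWitness[where f' = "\<lambda>(is, js). (hd is, tl is, tl js)"] subsetI ballI)
    fix x assume "x \<in> (SIGMA i:{1..\<delta>}. S (a - i) (b - (Suc \<delta> - i)) \<gamma>s)"
    then show "(\<lambda>(is, js). (hd is, tl is, tl js)) ((\<lambda>(i, is, js). (i # is, (Suc \<delta> - i) # js)) x) = x"
      by auto
  next
    fix y assume "y \<in> S a b (\<delta> # \<gamma>s)"
    then show "(\<lambda>(i, is, js). (i # is, (Suc \<delta> - i) # js)) ((\<lambda>(is, js). (hd is, tl is, tl js)) y) = y"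
      by (auto simp: S_def length_Suc_conv)
  next
    fix y assume "y \<in> (\<lambda>(i, is, js). (i # is, (Suc \<delta> - i) # js)) `
        (SIGMA i:{1..\<delta>}. S (a - i) (b - (Suc \<delta> - i)) \<gamma>s)"
    then obtain i "is" js where y: "y = (i # is, (Suc \<delta> - i) # js)" and i: "i \<in> {1..\<delta>}"
      and m: "(is, js) \<in> S (a - i) (b - (Suc \<delta> - i)) \<gamma>s"
      by auto
    show "y \<in> S a b (\<delta> # \<gamma>s)"
      using pos[OF m] m i unfolding S_def y by (auto simp: nth_Cons split: nat.splits)
  next
    fix x assume "x \<in> (\<lambda>(is, js). (hd is, tl is, tl js)) ` S a b (\<delta> # \<gamma>s)"
    then obtain i "is" j js where x: "x = (i, is, js)" and m: "(i # is, j # js) \<in> S a b (\<delta> # \<gamma>s)"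
      by (auto simp: S_def length_Suc_conv)
    have all: "0 < (i # is) ! k \<and> 0 < (j # js) ! k \<and> (i # is) ! k + (j # js) ! k = (\<delta> # \<gamma>s) ! k + 1"
      if "k < Suc (length \<gamma>s)" for k
      using m that unfolding S_def by simp
    have "0 < i" "0 < j" "i + j = \<delta> + 1"
      and "\<forall>k<length \<gamma>s. 0 < is ! k \<and> 0 < js ! k \<and> is ! k + js ! k = \<gamma>s ! k + 1"
      using all[of 0] all[of "Suc k" for k] by auto
    then show "x \<in> (SIGMA i:{1..\<delta>}. S (a - i) (b - (Suc \<delta> - i)) \<gamma>s)"
      using m unfolding S_def x by auto
  qed
  then show ?thesis
    unfolding P by (simp flip: bij_betw_same_card add: fin card_SigmaI)
qed

text \<open>Any entry before the last may be split off, since successive subtractions and the two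
  sums commute.\<close>

lemma P_hat_insert:
  assumes "ys \<noteq> []"
  shows "P_hat a b (xs @ \<delta> # ys) = (\<Sum>i = 1..\<delta>. P_hat (a - i) (b - (Suc \<delta> - i)) (xs @ ys))"
proof (induction xs arbitrary: a b)
  case Nil
  then show ?case using assms by (simp add: P_hat_Cons)
next
  case (Cons x xs)
  have "P_hat a b ((x # xs) @ \<delta> # ys) = (\<Sum>j = 1..x. \<Sum>i = 1..\<delta>.
      P_hat (a - j - i) (b - (Suc x - j) - (Suc \<delta> - i)) (xs @ ys))"
    by (simp add: P_hat_Cons Cons.IH)
  also have "\<dots> = (\<Sum>i = 1..\<delta>. \<Sum>j = 1..x.
      P_hat (a - i - j) (b - (Suc \<delta> - i) - (Suc x - j)) (xs @ ys))"
    by (subst sum.swap) (simp only: diff_diff_left add.commute)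
  finally show ?case using assms by (simp add: P_hat_Cons)
qed

section \<open>Derivatives at the origin\<close>

text \<open>Leibniz rule: each derivative hits either a value of \<open>g\<close> or one linear
  coordinate factor. In the latter case the factor becomes 1 and the entry \<open>L ! k\<close>
  leaves the list. One derivative suffices to kill \<open>K\<close>.\<close>

lemma differentiate_recursion:
  fixes g :: "nat \<Rightarrow> nat \<Rightarrow> rat_mpoly" and N :: nat
  defines "D \<equiv> foldr (\<lambda>\<gamma>. pd (N + 1 - \<gamma>))"
  assumes rec: "\<And>t. mpoly_eval (g a b) t + (\<Sum>\<delta> = 1..N. t (N + 1 - \<delta>) *
      (\<Sum>i = 1..\<delta>. mpoly_eval (g (a - i) (b - (Suc \<delta> - i))) t)) = K"
  shows "set L \<subseteq> {1..N} \<Longrightarrow> mpoly_eval (D L (g a b)) t + (\<Sum>\<delta> = 1..N. t (N + 1 - \<delta>) *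
      (\<Sum>i = 1..\<delta>. mpoly_eval (D L (g (a - i) (b - (Suc \<delta> - i)))) t)) +
      (\<Sum>k<length L. \<Sum>i = 1..L ! k.
         mpoly_eval (D (take k L @ drop (Suc k) L) (g (a - i) (b - (Suc (L ! k) - i)))) t)
    = (if L = [] then K else 0)"
proof (induction L arbitrary: t)
  case Nil
  then show ?case using rec[of t] by (simp add: D_def)
next
  case (Cons x L)
  define j where "j = N + 1 - x"
  have D_Cons: "D (x # M) p = pd j (D M p)" for M p
    by (simp add: D_def j_def)
  \<comment> \<open>The reflection sending \<open>\<delta>\<close> to
    \<open>N + 1 - \<delta>\<close> is injective on \<open>{1..N}\<close>, so only
    \<open>\<delta> = x\<close> depends on the variable \<open>j\<close>.\<close>
  have coord: "((\<lambda>u. (t(j := u)) (N + 1 - \<delta>)) has_field_derivative of_bool (\<delta> = x)) (at (t j))"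
    if "\<delta> \<in> {1..N}" for \<delta>
  proof -
    have "N + 1 - \<delta> = j \<longleftrightarrow> \<delta> = x"
      using that Cons.prems by (auto simp: j_def)
    then show ?thesis by (cases "\<delta> = x") auto
  qed
  have eval: "((\<lambda>u. mpoly_eval p (t(j := u))) has_field_derivative mpoly_eval (pd j p) t) (at (t j))" for p
    using mpoly_eval_has_derivative[of p t j "t j"] by simp
  let ?s = "\<lambda>M d t. \<Sum>i = 1..d. mpoly_eval (D M (g (a - i) (b - (Suc d - i)))) t"
  have s: "((\<lambda>u. ?s M d (t(j := u))) has_field_derivative ?s (x # M) d t) (at (t j))" for M d
    unfolding D_Cons by (intro DERIV_sum eval)
  have "((\<lambda>u. mpoly_eval (D L (g a b)) (t(j := u)) +
       (\<Sum>\<delta> = 1..N. (t(j := u)) (N + 1 - \<delta>) * ?s L \<delta> (t(j := u))) +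
       (\<Sum>k<length L. ?s (take k L @ drop (Suc k) L) (L ! k) (t(j := u))))
     has_field_derivative mpoly_eval (D (x # L) (g a b)) t +
       (\<Sum>\<delta> = 1..N. of_bool (\<delta> = x) * ?s L \<delta> (t(j := t j)) + ?s (x # L) \<delta> t * (t(j := t j)) (N + 1 - \<delta>)) +
       (\<Sum>k<length L. ?s (x # take k L @ drop (Suc k) L) (L ! k) t)) (at (t j))"
    using eval[of "D L (g a b)"] unfolding D_Cons[symmetric]
    by (intro DERIV_add DERIV_sum DERIV_mult coord s)
  moreover have "(\<lambda>u. mpoly_eval (D L (g a b)) (t(j := u)) +
       (\<Sum>\<delta> = 1..N. (t(j := u)) (N + 1 - \<delta>) * ?s L \<delta> (t(j := u))) +
       (\<Sum>k<length L. ?s (take k L @ drop (Suc k) L) (L ! k) (t(j := u)))) =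
     (\<lambda>u. if L = [] then K else 0)"
    using Cons.prems by (intro ext Cons.IH) simp
  \<comment> \<open>By the induction hypothesis the differentiated function is constant along the
    line.\<close>
  ultimately have "mpoly_eval (D (x # L) (g a b)) t +
       (\<Sum>\<delta> = 1..N. of_bool (\<delta> = x) * ?s L \<delta> t + ?s (x # L) \<delta> t * t (N + 1 - \<delta>)) +
       (\<Sum>k<length L. ?s (x # take k L @ drop (Suc k) L) (L ! k) t) = 0"
    using DERIV_unique[OF _ DERIV_const[of "if L = [] then K else 0"]] by (simp only: fun_upd_triv)
  moreover have "(\<Sum>\<delta> = 1..N. of_bool (\<delta> = x) * ?s L \<delta> t) = ?s L x t"
  proof -
    have "(\<Sum>\<delta> = 1..N. of_bool (\<delta> = x) * ?s L \<delta> t) = (\<Sum>\<delta> = 1..N. if \<delta> = x then ?s L x t else 0)"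
      by (intro sum.cong) auto
    then show ?thesis using Cons.prems by simp
  qed
  \<comment> \<open>The term \<open>k = 0\<close> is where the new derivative hits its own
    coordinate; the others add \<open>x\<close> to the previous lists.\<close>
  moreover have "(\<Sum>k<length (x # L). ?s (take k (x # L) @ drop (Suc k) (x # L)) ((x # L) ! k) t)
      = ?s L x t + (\<Sum>k<length L. ?s (x # take k L @ drop (Suc k) L) (L ! k) t)"
    unfolding length_Cons sum.lessThan_Suc_shift by simp
  ultimately show ?case
    by (simp add: sum.distrib mult.commute add_ac)
qed

text \<open>At the origin the terms with a coordinate factor drop out, leaving lists shorter by one
  entry. By \<open>P_hat_insert\<close> every choice of the removed entry contributes the same
  count.\<close>

lemma value_at_0:
  fixes g :: "nat \<Rightarrow> nat \<Rightarrow> rat_mpoly" and N :: nat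
  defines "D \<equiv> foldr (\<lambda>\<gamma>. pd (N + 1 - \<gamma>))"
  assumes rec: "\<And>a b t. 0 < a \<Longrightarrow> 0 < b \<Longrightarrow> a + b \<le> N + 1 \<Longrightarrow>
      mpoly_eval (g a b) t + (\<Sum>\<delta> = 1..N. t (N + 1 - \<delta>) *
      (\<Sum>i = 1..\<delta>. mpoly_eval (g (a - i) (b - (Suc \<delta> - i))) t)) = of_bool (a + b = Suc \<gamma>)"
    and g_0: "\<And>a. g 0 a = 0" "\<And>a. g a 0 = 0"
  shows "set L \<subseteq> {1..N} \<Longrightarrow> a + b \<le> N + 1 \<Longrightarrow>
    mpoly_eval (D L (g a b)) (\<lambda>_. 0) = (- 1) ^ length L * fact (length L) * of_nat (P_hat a b (L @ [\<gamma>]))"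
proof (induction "length L" arbitrary: L a b rule: less_induct)
  case less
  have D_0: "D L 0 = 0" by (induction L) (simp_all add: D_def)
  show ?case
  proof (cases "a = 0 \<or> b = 0")
    case True
    then show ?thesis by (auto simp: g_0 D_0 P_hat_0)
  next
    case False
    let ?n = "length L"
    have "mpoly_eval (g a b) t + (\<Sum>\<delta> = 1..N. t (N + 1 - \<delta>) *
      (\<Sum>i = 1..\<delta>. mpoly_eval (g (a - i) (b - (Suc \<delta> - i))) t)) = of_bool (a + b = Suc \<gamma>)" for t
      using rec False less.prems by simp
    note diff = differentiate_recursion[OF this less.prems(1), of "\<lambda>_. 0", folded D_def]
    have "mpoly_eval (D L (g a b)) (\<lambda>_. 0) = (if L = [] then of_bool (a + b = Suc \<gamma>) else 0) -
       (\<Sum>k<?n. \<Sum>i = 1..L ! k.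
         mpoly_eval (D (take k L @ drop (Suc k) L) (g (a - i) (b - (Suc (L ! k) - i)))) (\<lambda>_. 0))"
      using diff by (simp add: eq_diff_eq)
    also have "(\<Sum>k<?n. \<Sum>i = 1..L ! k.
         mpoly_eval (D (take k L @ drop (Suc k) L) (g (a - i) (b - (Suc (L ! k) - i)))) (\<lambda>_. 0))
       = (\<Sum>k<?n. (- 1) ^ (?n - 1) * fact (?n - 1) * of_nat (P_hat a b (L @ [\<gamma>])))"
    proof (intro sum.cong refl)
      fix k assume k: "k \<in> {..<?n}"
      let ?M = "take k L @ drop (Suc k) L"
      have "length ?M = ?n - 1" using k by simp
      moreover have "set ?M \<subseteq> {1..N}"
        using less.prems(1) set_take_subset[of k L] set_drop_subset[of "Suc k" L] by auto
      ultimately have "mpoly_eval (D ?M (g (a - i) (b - (Suc (L ! k) - i)))) (\<lambda>_. 0) =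
          (- 1) ^ (?n - 1) * fact (?n - 1) * of_nat (P_hat (a - i) (b - (Suc (L ! k) - i)) (?M @ [\<gamma>]))" for i
        using less.hyps[of ?M "a - i" "b - (Suc (L ! k) - i)"] less.prems k by auto
      moreover have "P_hat a b (L @ [\<gamma>]) = (\<Sum>i = 1..L ! k. P_hat (a - i) (b - (Suc (L ! k) - i)) (?M @ [\<gamma>]))"
      proof -
        have "L @ [\<gamma>] = take k L @ L ! k # (drop (Suc k) L @ [\<gamma>])"
          using k id_take_nth_drop[of k L] by (metis append.assoc append_Cons lessThan_iff)
        then show ?thesis
          by (subst \<open>L @ [\<gamma>] = _\<close>) (simp add: P_hat_insert)
      qed
      ultimately show "(\<Sum>i = 1..L ! k. mpoly_eval (D ?M (g (a - i) (b - (Suc (L ! k) - i)))) (\<lambda>_. 0)) =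
          (- 1) ^ (?n - 1) * fact (?n - 1) * of_nat (P_hat a b (L @ [\<gamma>]))"
        by (simp only: sum_distrib_left of_nat_sum)
    qed
    \<comment> \<open>There are \<open>?n\<close> equal summands, entering with a minus sign; this
      raises the factorial and flips the sign.\<close>
    finally show ?thesis
      using False by (cases L) (auto simp: P_hat_singleton algebra_simps)
  qed
qed

text \<open>\<open>flat_poly_mult\<close> paired with the polynomial of index
  \<open>N + 1 - \<gamma>\<close>. The value 0 of \<open>g\<close> at a zero index mirrors
  \<open>flat_poly s 0 = 0\<close>.\<close>

lemma potential_recursion:
  assumes "N \<ge> 1" "is_A_potential N F" "\<gamma> \<in> {1..N}" "0 < a" "0 < b" "a + b \<le> N + 1"
  defines "g \<equiv> \<lambda>a b. if a = 0 \<or> b = 0 then 0 else pd a (pd b (pd (N + 1 - \<gamma>) F))"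
  shows "mpoly_eval (g a b) t + (\<Sum>\<delta> = 1..N. t (N + 1 - \<delta>) *
      (\<Sum>i = 1..\<delta>. mpoly_eval (g (a - i) (b - (Suc \<delta> - i))) t)) = of_bool (a + b = Suc \<gamma>)"
proof -
  let ?s = "dual_coord N t"
  let ?p = "flat_poly ?s" and ?\<mu> = "N + 1 - \<gamma>"
  let ?e = "\<lambda>q. residue_pairing (?p (Suc N)) (q * ?p ?\<mu>)"
  have \<mu>: "?\<mu> \<in> {1..N}" using assms by auto
  have g: "mpoly_eval (g c d) t = ?e (?p c * ?p d)" if "c \<le> N" "d \<le> N" for c d
  proof (cases "c = 0 \<or> d = 0")
    case False
    then have cd: "c \<in> {1..N}" "d \<in> {1..N}" using that by auto
    have "mpoly_eval (pd c (pd d (pd ?\<mu> F))) t = eta N (v_of N t)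
        (tangent_prod N (v_of N t) (flat_field N t c) (flat_field N t d)) (flat_field N t ?\<mu>)"
      using assms(2) cd \<mu> unfolding is_A_potential_def by blast
    then show ?thesis
      using False assms(1) cd \<mu>
      by (simp add: g_def eta_tangent_prod dLambda_flat tangent_poly_flat_field)
  qed (auto simp: g_def)
  have g_ab: "mpoly_eval (g a b) t = ?e (?p a * ?p b)"
    and g_diff: "mpoly_eval (g (a - i) (b - d)) t = ?e (?p (a - i) * ?p (b - d))" for i d
    by (rule g; use assms(4-6) in simp)+
  have "?e (?p a * ?p b + (\<Sum>\<delta> = 1..N. smult (?s \<delta>)
         (\<Sum>i = 1..\<delta>. ?p (a - i) * ?p (b - (Suc \<delta> - i))))) = ?e (?p (a + b - 1))"
    using assms by (subst flat_poly_mult) auto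
  \<comment> \<open>The bound on \<open>a + b\<close> places \<open>a + b - 1\<close> in
    \<open>{1..N}\<close>, where the orthogonality relation applies.\<close>
  also have "\<dots> = of_bool (a + b - 1 + ?\<mu> = Suc N)"
    using assms \<mu> by (intro residue_pairing_flat_poly) auto
  also have "a + b - 1 + ?\<mu> = Suc N \<longleftrightarrow> a + b = Suc \<gamma>"
    using assms by auto
  finally have "mpoly_eval (g a b) t + (\<Sum>\<delta> = 1..N. ?s \<delta> *
      (\<Sum>i = 1..\<delta>. mpoly_eval (g (a - i) (b - (Suc \<delta> - i))) t)) = of_bool (a + b = Suc \<gamma>)"
    by (simp only: g_ab g_diff distrib_right sum_distrib_right mult_smult_left
        residue_pairing_add residue_pairing_sum residue_pairing_smult)
  then show ?thesis
    by (simp add: dual_coord_def)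
qed

theorem corollary5p2:
  fixes N m \<alpha> \<beta> :: nat and \<gamma>s :: "nat list" and F :: rat_mpoly
  assumes "N \<ge> 1"
    and "is_A_potential N F"
    and "\<alpha> > 0" and "\<beta> > 0" and "\<alpha> + \<beta> \<le> N + 1"
    and "m \<ge> 1" and "length \<gamma>s = m" and "set \<gamma>s \<subseteq> {1..N}"
  shows "mpoly_eval (pd \<alpha> (pd \<beta> (foldr (\<lambda>\<gamma>. pd (N + 1 - \<gamma>)) \<gamma>s F))) (\<lambda>_. 0)
           = (- 1) ^ (m - 1) * fact (m - 1) * of_nat (P_hat \<alpha> \<beta> \<gamma>s)"
proof -
  \<comment> \<open>The last entry supplies the third index of the third derivatives; the others are
    differentiated afterwards, whence \<open>m - 1\<close> in the factorial.\<close>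
  obtain L \<gamma> where \<gamma>s: "\<gamma>s = L @ [\<gamma>]"
    using assms(6,7) by (cases \<gamma>s rule: rev_cases) auto
  then have \<gamma>: "\<gamma> \<in> {1..N}" and L: "set L \<subseteq> {1..N}" and m: "m - 1 = length L"
    using assms(7,8) by auto
  show ?thesis
    unfolding \<gamma>s m
    using value_at_0[OF potential_recursion[OF assms(1,2) \<gamma>] _ _ L assms(5)] assms(3,4)
    by (simp add: pd_foldr_commute)
qed

end
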